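(* Let $\tilde{\mathbb{G}}$ be the neutral metric of the conformal compactification of $\mathbb{R}^{2,2}$ into the 4-ball $B^4$, with null boundary 3-sphere $\partial B^4=\{p=\pi/2\}$. Then both the $\alpha$-planes and the $\beta$-planes on the boundary are integrable distributions.
   Context: $\mathbb{R}^{2,2}$ is $\mathbb{R}^4$ with the flat neutral metric $\mathbb{G}=(dx^1)^2+(dx^2)^2-(dx^3)^2-(dx^4)^2$. Introduce coordinates by $x^1+ix^2=R_1e^{i\theta_1}$, $x^3+ix^4=R_2e^{i\theta_2}$, $\tan p=R_1+R_2$, $\tan q=R_1-R_2$, with $0\le p<\pi/2$, $-p\le q\le p$, $0\le\theta_1,\theta_2<2\pi$. Points at infinity correspond to $p=\pi/2$. The compactification is the 4-ball $B^4\subset\mathbb{C}^2$ with $z_1=p\cos(\psi/2)e^{i\theta_1}$, $z_2=p\sin(\psi/2)e^{i\theta_2}$, where $q=p\cos\psi$, $0\le\psi\le\pi$; its boundary $p=\pi/2$ is a 3-sphere. The conformal metric is $$\tilde{\mathbb{G}}=4\cos^2p\cos^2q\;\mathbb{G}=dp\,dq+\tfrac14\sin^2(p+q)\,d\theta_1^2-\tfrac14\sin^2(p-q)\,d\theta_2^2 .$$ The boundary is a null hypersurface with coordinates $(q,\theta_1,\theta_2)$. The metric induced on a null hypersurface by a neutral metric has degenerate signature $(0,+,-)$, and its null tangent vectors at a point form two totally null planes (planes on which the metric vanishes identically), called the $\alpha$-plane and the $\beta$-plane, which intersect along the normal of the hypersurface. On the boundary these are considered at the points $|q|<\pi/2$,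 i.e. off the Hopf link $q=\pm\pi/2$, where the induced metric vanishes. *)

theory Defs
  imports "HOL-Analysis.Analysis"
begin

section \<open>The ball and its coordinates\<close>

text \<open>
  The 4-ball is \<open>cball 0 (pi / 2)\<close> in \<open>\<complex>\<^sup>2\<close>, and its tangent vectors are elements of
  the real vector space \<open>\<complex>\<^sup>2\<close>.  In terms of
  \<open>z\<^sub>1 = p cos (\<psi> / 2) e\<^bsup>i\<theta>\<^sub>1\<^esup>\<close>, \<open>z\<^sub>2 = p sin (\<psi> / 2) e\<^bsup>i\<theta>\<^sub>2\<^esup>\<close> and \<open>q = p cos \<psi>\<close>,
  the coordinates \<open>p\<close> and \<open>q\<close> are the functions below; see \<open>coord_p_q_ball_point\<close>.
\<close>

definition ball_point :: "real \<Rightarrow> real \<Rightarrow> real \<Rightarrow> real \<Rightarrow> complex \<times> complex" where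
  "ball_point p \<psi> \<theta>1 \<theta>2 =
     (of_real (p * cos (\<psi> / 2)) * cis \<theta>1, of_real (p * sin (\<psi> / 2)) * cis \<theta>2)"

definition coord_p :: "complex \<times> complex \<Rightarrow> real" where
  "coord_p z = norm z"

definition coord_q :: "complex \<times> complex \<Rightarrow> real" where
  "coord_q z = ((cmod (fst z))\<^sup>2 - (cmod (snd z))\<^sup>2) / norm z"

lemma norm_ball_point:
  assumes "0 \<le> p"
  shows "norm (ball_point p \<psi> \<theta>1 \<theta>2) = p"
proof -
  have "(p * cos (\<psi> / 2))\<^sup>2 + (p * sin (\<psi> / 2))\<^sup>2 = p\<^sup>2 * ((sin (\<psi> / 2))\<^sup>2 + (cos (\<psi> / 2))\<^sup>2)"
    by (simp add: power_mult_distrib algebra_simps del: sin_cos_squared_add sin_cos_squared_add2)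
  then show ?thesis
    using assms by (simp add: ball_point_def norm_Pair norm_mult power_mult_distrib)
qed

lemma coord_p_q_ball_point:
  assumes "0 < p"
  shows "coord_p (ball_point p \<psi> \<theta>1 \<theta>2) = p"
    and "coord_q (ball_point p \<psi> \<theta>1 \<theta>2) = p * cos \<psi>"
proof -
  show "coord_p (ball_point p \<psi> \<theta>1 \<theta>2) = p"
    using assms by (simp add: coord_p_def norm_ball_point)
  have "cos \<psi> = (cos (\<psi> / 2))\<^sup>2 - (sin (\<psi> / 2))\<^sup>2"
    using cos_double[of "\<psi> / 2"] by simp
  moreover have "coord_q (ball_point p \<psi> \<theta>1 \<theta>2)
      = ((p * cos (\<psi> / 2))\<^sup>2 - (p * sin (\<psi> / 2))\<^sup>2) / p"
    using assms by (simp add: coord_q_def norm_ball_point) (simp add: ball_point_def norm_mult power_mult_distrib)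
  moreover have "((p * cos (\<psi> / 2))\<^sup>2 - (p * sin (\<psi> / 2))\<^sup>2) / p
      = p * ((cos (\<psi> / 2))\<^sup>2 - (sin (\<psi> / 2))\<^sup>2)"
    using assms by (simp add: power2_eq_square field_simps)
  ultimately show "coord_q (ball_point p \<psi> \<theta>1 \<theta>2) = p * cos \<psi>"
    by simp
qed

definition dp :: "complex \<times> complex \<Rightarrow> complex \<times> complex \<Rightarrow> real" where
  "dp z v = frechet_derivative coord_p (at z) v"

definition dq :: "complex \<times> complex \<Rightarrow> complex \<times> complex \<Rightarrow> real" where
  "dq z v = frechet_derivative coord_q (at z) v"

text \<open>
  \<open>\<theta>\<^sub>1\<close> and \<open>\<theta>\<^sub>2\<close> are multi-valued, but their differentials are not: they are the imaginary
  parts of \<open>dz\<^sub>1 / z\<^sub>1\<close> and \<open>dz\<^sub>2 / z\<^sub>2\<close>.  They are meaningful where \<open>z\<^sub>1\<close>, respectively \<open>z\<^sub>2\<close>,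
  does not vanish.
\<close>

definition dtheta1 :: "complex \<times> complex \<Rightarrow> complex \<times> complex \<Rightarrow> real" where
  "dtheta1 z v = Im (fst v / fst z)"

definition dtheta2 :: "complex \<times> complex \<Rightarrow> complex \<times> complex \<Rightarrow> real" where
  "dtheta2 z v = Im (snd v / snd z)"


section \<open>The conformal metric\<close>

text \<open>
  The product \<open>dp dq\<close> in the line element is the symmetric product, whose associated
  bilinear form is \<open>(dp \<otimes> dq + dq \<otimes> dp) / 2\<close>.
\<close>

definition conf_metric ::
  "complex \<times> complex \<Rightarrow> complex \<times> complex \<Rightarrow> complex \<times> complex \<Rightarrow> real" where
  "conf_metric z v w =
     (dp z v * dq z w + dp z w * dq z v) / 2
     + (sin (coord_p z + coord_q z))\<^sup>2 / 4 * (dtheta1 z v * dtheta1 z w)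
     - (sin (coord_p z - coord_q z))\<^sup>2 / 4 * (dtheta2 z v * dtheta2 z w)"

text \<open>
  The flat neutral metric on \<open>\<real>\<^sup>4 = \<complex>\<^sup>2\<close>, and the identification of the open ball with
  \<open>\<real>\<^sup>4\<close>, given by \<open>R\<^sub>1 = (tan p + tan q) / 2\<close> and \<open>R\<^sub>2 = (tan p - tan q) / 2\<close> with
  unchanged angles.
\<close>

definition flat_metric :: "complex \<times> complex \<Rightarrow> complex \<times> complex \<Rightarrow> real" where
  "flat_metric v w = fst v \<bullet> fst w - snd v \<bullet> snd w"

definition decompactify :: "complex \<times> complex \<Rightarrow> complex \<times> complex" where
  "decompactify z =
     (of_real ((tan (coord_p z) + tan (coord_q z)) / 2) * sgn (fst z),
      of_real ((tan (coord_p z) - tan (coord_q z)) / 2) * sgn (snd z))"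

lemma has_derivative_coord_p:
  assumes "z \<noteq> 0"
  shows "(coord_p has_derivative dp z) (at z)"
proof -
  have "coord_p = norm" by (auto simp: coord_p_def)
  then have "coord_p differentiable (at z)"
    using assms by simp
  then show ?thesis
    unfolding dp_def frechet_derivative_works by (simp add: eta_contract_eq)
qed

lemma has_derivative_coord_q:
  assumes "z \<noteq> 0"
  shows "(coord_q has_derivative dq z) (at z)"
proof -
  have eq: "coord_q = (\<lambda>z. (fst z \<bullet> fst z - snd z \<bullet> snd z) / norm z)"
    by (auto simp: coord_q_def dot_square_norm)
  have "norm differentiable (at z)"
    using has_derivative_coord_p[OF assms] by (auto simp: differentiable_def coord_p_def[abs_def])
  moreover have "(\<lambda>z. fst z \<bullet> fst z - snd z \<bullet> snd z) differentiable (at z)"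
    unfolding differentiable_def by (rule exI) (auto intro!: derivative_eq_intros)
  ultimately have "coord_q differentiable (at z)"
    unfolding eq using assms by (intro differentiable_divide) auto
  then show ?thesis
    unfolding dq_def frechet_derivative_works by (simp add: eta_contract_eq)
qed

lemma has_derivative_sgn_complex:
  fixes z :: complex
  assumes "z \<noteq> 0"
  shows "(sgn has_derivative (\<lambda>v. of_real (Im (v / z)) * \<i> * sgn z)) (at z)"
proof -
  have "((\<lambda>z::complex. z /\<^sub>R norm z) has_derivative
      (\<lambda>v. v /\<^sub>R norm z - ((z \<bullet> v) / norm z ^ 3) *\<^sub>R z)) (at z)"
    using assms
    by (auto intro!: derivative_eq_intros has_derivative_norm
        simp: fun_eq_iff divide_simps power3_eq_cube power2_eq_square sgn_div_norm inner_commute)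
  moreover have "v /\<^sub>R norm z - ((z \<bullet> v) / norm z ^ 3) *\<^sub>R z
      = of_real (Im (v / z)) * \<i> * sgn z" for v
  proof -
    define w where "w = v / z"
    have v: "v = z * w"
      using assms by (simp add: w_def)
    have "z \<bullet> v = (norm z)\<^sup>2 * Re w"
      unfolding v cmod_power2 by (simp add: inner_complex_def algebra_simps power2_eq_square)
    then have "(z \<bullet> v) / norm z ^ 3 = Re w / norm z"
      using assms by (simp add: power3_eq_cube power2_eq_square)
    then have "v /\<^sub>R norm z - ((z \<bullet> v) / norm z ^ 3) *\<^sub>R z = (w - of_real (Re w)) * (z /\<^sub>R norm z)"
      unfolding v by (simp add: scaleR_conv_of_real divide_inverse algebra_simps)
    also have "w - of_real (Re w) = of_real (Im w) * \<i>"
      by (simp add: complex_eq_iff)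
    finally show ?thesis
      by (simp add: w_def sgn_div_norm)
  qed
  ultimately show ?thesis
    by (simp add: sgn_div_norm[abs_def])
qed

lemma conf_metric_eq_pullback:
  assumes z: "norm z < pi / 2" and z1: "fst z \<noteq> 0" and z2: "snd z \<noteq> 0"
  shows "\<exists>D. (decompactify has_derivative D) (at z) \<and>
    (\<forall>v w. conf_metric z v w =
       (cos (coord_p z))\<^sup>2 * (cos (coord_q z))\<^sup>2 * flat_metric (D v) (D w))"
proof -
  let ?p = "coord_p z" and ?q = "coord_q z"
  have z0: "z \<noteq> 0" using z1 by auto
  have np: "?p < pi / 2" "0 < ?p" using z z0 by (auto simp: coord_p_def)
  have nz: "(norm z)\<^sup>2 = (cmod (fst z))\<^sup>2 + (cmod (snd z))\<^sup>2"
    by (simp add: norm_prod_def)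
  have "\<bar>?q\<bar> \<le> ?p"
  proof -
    have "\<bar>(cmod (fst z))\<^sup>2 - (cmod (snd z))\<^sup>2\<bar> \<le> (norm z)\<^sup>2"
      unfolding nz abs_le_iff by simp
    then show ?thesis using z0
      by (simp add: coord_p_def coord_q_def divide_simps power2_eq_square)
  qed
  then have cq: "cos ?q > 0" and cp: "cos ?p > 0"
    using np by (auto intro!: cos_gt_zero_pi)
  define A where "A v = (dp z v / (cos ?p)\<^sup>2 + dq z v / (cos ?q)\<^sup>2) / 2" for v
  define B where "B v = (dp z v / (cos ?p)\<^sup>2 - dq z v / (cos ?q)\<^sup>2) / 2" for v
  define R1 where "R1 = (tan ?p + tan ?q) / 2"
  define R2 where "R2 = (tan ?p - tan ?q) / 2"
  define D where "D v =
     (of_real (A v) * sgn (fst z) + of_real R1 * (of_real (dtheta1 z v) * \<i> * sgn (fst z)),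
      of_real (B v) * sgn (snd z) + of_real R2 * (of_real (dtheta2 z v) * \<i> * sgn (snd z)))" for v
  have tp: "((\<lambda>z. tan (coord_p z)) has_derivative (\<lambda>v. dp z v / (cos ?p)\<^sup>2)) (at z)"
    using has_derivative_compose[OF has_derivative_coord_p[OF z0]
        DERIV_tan[of ?p, unfolded has_field_derivative_def]] cp
    by (simp add: field_simps)
  have tq: "((\<lambda>z. tan (coord_q z)) has_derivative (\<lambda>v. dq z v / (cos ?q)\<^sup>2)) (at z)"
    using has_derivative_compose[OF has_derivative_coord_q[OF z0]
        DERIV_tan[of ?q, unfolded has_field_derivative_def]] cq
    by (simp add: field_simps)
  have s1: "((\<lambda>z. sgn (fst z)) has_derivative (\<lambda>v. of_real (dtheta1 z v) * \<i> * sgn (fst z))) (at z)"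
    unfolding dtheta1_def
    by (rule has_derivative_compose[where f = fst and f' = fst,
          OF has_derivative_fst[OF has_derivative_ident] has_derivative_sgn_complex[OF z1]])
  have s2: "((\<lambda>z. sgn (snd z)) has_derivative (\<lambda>v. of_real (dtheta2 z v) * \<i> * sgn (snd z))) (at z)"
    unfolding dtheta2_def
    by (rule has_derivative_compose[where f = snd and f' = snd,
          OF has_derivative_snd[OF has_derivative_ident] has_derivative_sgn_complex[OF z2]])
  have r1: "((\<lambda>z. complex_of_real ((tan (coord_p z) + tan (coord_q z)) / 2)) has_derivative
      (\<lambda>v. of_real (A v))) (at z)"
    unfolding A_def
    by (intro has_derivative_of_real has_derivative_add tp tq
        bounded_linear.has_derivative[OF bounded_linear_divide])
  have r2: "((\<lambda>z. complex_of_real ((tan (coord_p z) - tan (coord_q z)) / 2)) has_derivative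
      (\<lambda>v. of_real (B v))) (at z)"
    unfolding B_def
    by (intro has_derivative_of_real has_derivative_diff tp tq
        bounded_linear.has_derivative[OF bounded_linear_divide])
  have "(decompactify has_derivative D) (at z)"
    unfolding decompactify_def[abs_def] D_def[abs_def]
    using has_derivative_Pair[OF has_derivative_mult[OF r1 s1] has_derivative_mult[OF r2 s2]]
    by (simp add: R1_def R2_def add.commute)
  moreover have "conf_metric z v w =
       (cos ?p)\<^sup>2 * (cos ?q)\<^sup>2 * flat_metric (D v) (D w)" for v w
  proof -
    have inn: "(of_real a * s + of_real r * (of_real t * \<i> * s)) \<bullet>
        (of_real a' * s + of_real r * (of_real t' * \<i> * s)) = a * a' + r\<^sup>2 * (t * t')"
      if "cmod s = 1" for a a' r t t' and s :: complex
    proof -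
      have "(Re s)\<^sup>2 + (Im s)\<^sup>2 = 1" using that cmod_power2[of s] by simp
      then show ?thesis
        by (simp add: inner_complex_def) algebra
    qed
    have flat: "flat_metric (D v) (D w) =
       A v * A w - B v * B w + R1\<^sup>2 * (dtheta1 z v * dtheta1 z w) - R2\<^sup>2 * (dtheta2 z v * dtheta2 z w)"
      using z1 z2 by (simp add: flat_metric_def D_def inn norm_sgn)
    have R1: "R1 * (cos ?p * cos ?q) = sin (?p + ?q) / 2"
      using cp cq by (simp add: R1_def tan_def sin_add field_simps)
    have R2: "R2 * (cos ?p * cos ?q) = sin (?p - ?q) / 2"
      using cp cq by (simp add: R2_def tan_def sin_diff field_simps)
    have AB: "(cos ?p)\<^sup>2 * (cos ?q)\<^sup>2 * (A v * A w - B v * B w)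
        = (dp z v * dq z w + dp z w * dq z v) / 2"
    proof -
      have "a * b * ((x / a + y / b) / 2 * ((x' / a + y' / b) / 2)
            - (x / a - y / b) / 2 * ((x' / a - y' / b) / 2)) = (x * y' + x' * y) / 2"
        if "a \<noteq> 0" "b \<noteq> 0" for a b x y x' y' :: real
        using that by (simp add: field_simps)
      then show ?thesis
        using cp cq by (simp add: A_def B_def)
    qed
    have "(cos ?p)\<^sup>2 * (cos ?q)\<^sup>2 * flat_metric (D v) (D w) =
        (dp z v * dq z w + dp z w * dq z v) / 2
        + (R1 * (cos ?p * cos ?q))\<^sup>2 * (dtheta1 z v * dtheta1 z w)
        - (R2 * (cos ?p * cos ?q))\<^sup>2 * (dtheta2 z v * dtheta2 z w)"
      unfolding flat AB[symmetric] by (simp add: algebra_simps power_mult_distrib)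
    then show ?thesis
      unfolding R1 R2 conf_metric_def by (simp add: power_divide)
  qed
  ultimately show ?thesis by blast
qed


section \<open>Totally null planes on the boundary\<close>

text \<open>The boundary 3-sphere \<open>p = pi / 2\<close> without the Hopf link \<open>q = pi / 2\<close>, \<open>q = - pi / 2\<close>.\<close>

definition boundary_off_link :: "(complex \<times> complex) set" where
  "boundary_off_link = {z \<in> sphere 0 (pi / 2). \<bar>coord_q z\<bar> < pi / 2}"

definition sphere_tangent :: "complex \<times> complex \<Rightarrow> (complex \<times> complex) set" where
  "sphere_tangent z = {v. z \<bullet> v = 0}"

lemma dp_sphere_tangent:
  assumes "z \<noteq> 0" and "v \<in> sphere_tangent z"
  shows "dp z v = 0"
proof -
  have "coord_p = norm" by (auto simp: coord_p_def)
  then have "dp z = (\<lambda>h. h \<bullet> sgn z)"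
    using has_derivative_coord_p[OF assms(1)] has_derivative_norm[OF assms(1)]
    by (metis has_derivative_unique)
  then show ?thesis
    using assms(2) by (simp add: sphere_tangent_def sgn_div_norm inner_commute)
qed

lemma conf_metric_induced:
  assumes z: "z \<in> boundary_off_link" and vw: "v \<in> sphere_tangent z" "w \<in> sphere_tangent z"
  shows "conf_metric z v w =
    (cos (coord_q z))\<^sup>2 / 4 * (dtheta1 z v * dtheta1 z w - dtheta2 z v * dtheta2 z w)"
proof -
  have z0: "z \<noteq> 0" and p: "coord_p z = pi / 2"
    using z by (auto simp: boundary_off_link_def coord_p_def)
  show ?thesis
    unfolding conf_metric_def p using dp_sphere_tangent[OF z0] vw
    by (simp add: sin_add sin_diff algebra_simps)
qed

definition totally_null_plane :: "complex \<times> complex \<Rightarrow> (complex \<times> complex) set \<Rightarrow> bool" where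
  "totally_null_plane z P \<longleftrightarrow>
     subspace P \<and> dim P = 2 \<and> P \<subseteq> sphere_tangent z \<and> (\<forall>v\<in>P. \<forall>w\<in>P. conf_metric z v w = 0)"

definition wedge11 :: "('v \<Rightarrow> real) \<Rightarrow> ('v \<Rightarrow> real) \<Rightarrow> 'v \<Rightarrow> 'v \<Rightarrow> real" where
  "wedge11 \<xi> \<eta> a b = \<xi> a * \<eta> b - \<xi> b * \<eta> a"

definition wedge22 :: "('v \<Rightarrow> 'v \<Rightarrow> real) \<Rightarrow> ('v \<Rightarrow> 'v \<Rightarrow> real) \<Rightarrow> 'v \<Rightarrow> 'v \<Rightarrow> 'v \<Rightarrow> 'v \<Rightarrow> real" where
  "wedge22 \<omega> \<tau> a b c d =
     \<omega> a b * \<tau> c d - \<omega> a c * \<tau> b d + \<omega> a d * \<tau> b c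
     + \<omega> b c * \<tau> a d - \<omega> b d * \<tau> a c + \<omega> c d * \<tau> a b"

text \<open>
  The volume form of the conformal metric.  In the coordinates \<open>(p, q, \<theta>\<^sub>1, \<theta>\<^sub>2)\<close> the
  determinant of the metric is \<open>sin\<^sup>2 (p + q) sin\<^sup>2 (p - q) / 64\<close>, and both sines are
  nonnegative on the ball.  The orientation \<open>dp \<and> dq \<and> d\<theta>\<^sub>1 \<and> d\<theta>\<^sub>2\<close> agrees with
  \<open>dx\<^sup>1 \<and> dx\<^sup>2 \<and> dx\<^sup>3 \<and> dx\<^sup>4\<close> on \<open>\<real>\<^sup>4\<close>; reversing it exchanges the \<open>\<alpha>\<close>- and the \<open>\<beta>\<close>-planes.
\<close>

definition conf_volume ::
  "complex \<times> complex \<Rightarrow> complex \<times> complex \<Rightarrow> complex \<times> complex \<Rightarrow> complex \<times> complex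
    \<Rightarrow> complex \<times> complex \<Rightarrow> real" where
  "conf_volume z a b c d =
     sin (coord_p z + coord_q z) * sin (coord_p z - coord_q z) / 8
     * wedge22 (wedge11 (dp z) (dq z)) (wedge11 (dtheta1 z) (dtheta2 z)) a b c d"

text \<open>
  The pairing of the bivectors \<open>x \<and> y\<close> and \<open>v \<and> w\<close>.  As \<open>x \<and> y \<and> *(v \<and> w)\<close> is this pairing
  times the unit volume element, \<open>*(v \<and> w) = s (v \<and> w)\<close> holds for a sign \<open>s\<close> if and only if
  \<open>s conf_volume z x y v w = conf_pairing z x y v w\<close> for all \<open>x\<close> and \<open>y\<close>.  A totally null plane
  is an \<open>\<alpha>\<close>-plane if its bivectors are self-dual, and a \<open>\<beta>\<close>-plane if they are anti-self-dual.
\<close>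

definition conf_pairing ::
  "complex \<times> complex \<Rightarrow> complex \<times> complex \<Rightarrow> complex \<times> complex \<Rightarrow> complex \<times> complex
    \<Rightarrow> complex \<times> complex \<Rightarrow> real" where
  "conf_pairing z x y v w =
     conf_metric z x v * conf_metric z y w - conf_metric z x w * conf_metric z y v"

definition alpha_plane :: "complex \<times> complex \<Rightarrow> (complex \<times> complex) set \<Rightarrow> bool" where
  "alpha_plane z P \<longleftrightarrow> totally_null_plane z P \<and>
     (\<forall>v\<in>P. \<forall>w\<in>P. \<forall>x y. conf_volume z x y v w = conf_pairing z x y v w)"

definition beta_plane :: "complex \<times> complex \<Rightarrow> (complex \<times> complex) set \<Rightarrow> bool" where
  "beta_plane z P \<longleftrightarrow> totally_null_plane z P \<and>
     (\<forall>v\<in>P. \<forall>w\<in>P. \<forall>x y. - conf_volume z x y v w = conf_pairing z x y v w)"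


section \<open>Integrable plane distributions\<close>

text \<open>\<open>C\<^sup>k\<close> and smooth maps on an open subset of a finite-dimensional space.\<close>

primrec Ck_on ::
  "nat \<Rightarrow> 'a::euclidean_space set \<Rightarrow> ('a \<Rightarrow> 'b::real_normed_vector) \<Rightarrow> bool" where
  "Ck_on 0 S f \<longleftrightarrow> continuous_on S f"
| "Ck_on (Suc k) S f \<longleftrightarrow> (\<forall>x\<in>S. f differentiable (at x)) \<and>
     (\<forall>v. Ck_on k S (\<lambda>x. frechet_derivative f (at x) v))"

definition smooth_on :: "'a::euclidean_space set \<Rightarrow> ('a \<Rightarrow> 'b::real_normed_vector) \<Rightarrow> bool" where
  "smooth_on S f \<longleftrightarrow> (\<forall>k. Ck_on k S f)"

text \<open>
  A smooth distribution of 2-planes on a submanifold \<open>M\<close> of a Euclidean space, where \<open>T z\<close> is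
  the tangent space of \<open>M\<close> at \<open>z\<close>.  The local spanning fields are taken to be smooth on an open
  subset of the ambient space.
\<close>

definition plane_distribution ::
  "'a::euclidean_space set \<Rightarrow> ('a \<Rightarrow> 'a set) \<Rightarrow> ('a \<Rightarrow> 'a set) \<Rightarrow> bool" where
  "plane_distribution M T D \<longleftrightarrow>
     (\<forall>z\<in>M. subspace (D z) \<and> dim (D z) = 2 \<and> D z \<subseteq> T z) \<and>
     (\<forall>z\<in>M. \<exists>U X Y. open U \<and> z \<in> U \<and> smooth_on U X \<and> smooth_on U Y \<and>
        (\<forall>w\<in>M \<inter> U. D w = span {X w, Y w}))"

text \<open>A 2-dimensional integral manifold, as an injective immersion of an open set of parameters.\<close>

definition integral_surface ::
  "'a::euclidean_space set \<Rightarrow> ('a \<Rightarrow> 'a set) \<Rightarrow> (real \<times> real) set \<Rightarrow> (real \<times> real \<Rightarrow> 'a) \<Rightarrow> bool" where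
  "integral_surface M D W f \<longleftrightarrow>
     open W \<and> smooth_on W f \<and> inj_on f W \<and> f ` W \<subseteq> M \<and>
     (\<forall>s\<in>W. inj (frechet_derivative f (at s)) \<and>
        range (frechet_derivative f (at s)) = D (f s))"

definition integrable_distribution ::
  "'a::euclidean_space set \<Rightarrow> ('a \<Rightarrow> 'a set) \<Rightarrow> ('a \<Rightarrow> 'a set) \<Rightarrow> bool" where
  "integrable_distribution M T D \<longleftrightarrow>
     plane_distribution M T D \<and> (\<forall>z\<in>M. \<exists>W f. integral_surface M D W f \<and> z \<in> f ` W)"

end

theory Submission
  imports Defs
begin

text \<open>
  On the boundary the metric induced on the sphere is
  \<open>cos\<^sup>2 q (d\<theta>\<^sub>1\<^sup>2 - d\<theta>\<^sub>2\<^sup>2) / 4\<close>, and off the Hopf link \<open>cos q\<close> does not vanish.  As this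
  quadratic form is the product of the linear forms \<open>d\<theta>\<^sub>1 - d\<theta>\<^sub>2\<close> and \<open>d\<theta>\<^sub>1 + d\<theta>\<^sub>2\<close>, a
  totally null plane is contained in the union of their kernels, hence equal to one of them:
  there are exactly two such planes, \<open>null_plane s z\<close> given by \<open>d\<theta>\<^sub>2 = s d\<theta>\<^sub>1\<close> with \<open>s = 1\<close>
  and \<open>s = - 1\<close> (\<open>totally_null_plane_iff\<close>).  On the bivectors of \<open>null_plane s z\<close> the Hodge
  star acts as multiplication by \<open>- s\<close> (\<open>conf_volume_conf_pairing_null_plane\<close>), and the pairing
  of these bivectors with all others is not identically zero
  (\<open>conf_pairing_null_plane_nonzero\<close>).  So \<open>s = - 1\<close> gives the \<open>\<alpha>\<close>-plane and \<open>s = 1\<close> the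
  \<open>\<beta>\<close>-plane.

  Integrability is then visible, because \<open>d\<theta>\<^sub>2 - s d\<theta>\<^sub>1\<close> is closed: the leaves are the surfaces
  \<open>\<theta>\<^sub>2 - s \<theta>\<^sub>1 = const\<close>.  Each is parametrised by \<open>\<psi>\<close>, which moves \<open>q\<close>, and by an angle \<open>u\<close>
  that rotates \<open>z\<^sub>1\<close> by \<open>u\<close> and \<open>z\<^sub>2\<close> by \<open>s u\<close> (\<open>integral_surface_leaf\<close>).  The two parameter
  directions are, up to scale, the vector fields \<open>q_field\<close> and \<open>torus_field s\<close>, which are
  polynomial in the real coordinates of \<open>\<complex>\<^sup>2\<close> and span \<open>null_plane s\<close>
  (\<open>null_plane_eq_span\<close>).
\<close>


section \<open>Closure properties of smooth maps\<close>

lemma Ck_on_cong: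
  assumes "open S" "\<And>x. x \<in> S \<Longrightarrow> f x = g x" "Ck_on k S f"
  shows "Ck_on k S g"
  using assms(2,3)
proof (induction k arbitrary: f g)
  case 0
  then show ?case by (simp cong: continuous_on_cong)
next
  case (Suc k)
  have ev: "(f has_derivative D) (at x) \<longleftrightarrow> (g has_derivative D) (at x)" if "x \<in> S" for x D
    using has_derivative_transform_within_open[OF _ assms(1) that, of f D UNIV g]
      has_derivative_transform_within_open[OF _ assms(1) that, of g D UNIV f] Suc.prems(1)
    by metis
  have "frechet_derivative f (at x) v = frechet_derivative g (at x) v" if "x \<in> S" for x v
    using ev[OF that] by (simp add: frechet_derivative_def)
  moreover have "Ck_on k S (\<lambda>x. frechet_derivative f (at x) v)" for v
    using Suc.prems(2) by simp
  ultimately have "Ck_on k S (\<lambda>x. frechet_derivative g (at x) v)" for v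
    by (rule Suc.IH)
  moreover have "g differentiable (at x)" if "x \<in> S" for x
    using Suc.prems(2) that ev[OF that] unfolding differentiable_def Ck_on.simps by metis
  ultimately show ?case by simp
qed

text \<open>
  On an open set any explicit formula for the derivative may replace
  \<open>frechet_derivative\<close>; every closure property below is an induction on \<open>k\<close> through this rule.
\<close>

lemma Ck_on_SucI:
  assumes "open S" "\<And>x. x \<in> S \<Longrightarrow> (f has_derivative f' x) (at x)" "\<And>v. Ck_on k S (\<lambda>x. f' x v)"
  shows "Ck_on (Suc k) S f"
proof -
  have "Ck_on k S (\<lambda>x. frechet_derivative f (at x) v)" for v
    using frechet_derivative_at[OF assms(2)]
    by (intro Ck_on_cong[OF assms(1) _ assms(3)[of v]]) simp
  then show ?thesis
    using assms(2) by (auto simp: differentiable_def)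
qed

lemma Ck_on_SucD:
  assumes "Ck_on (Suc k) S f"
  shows "x \<in> S \<Longrightarrow> (f has_derivative frechet_derivative f (at x)) (at x)"
    and "Ck_on k S (\<lambda>x. frechet_derivative f (at x) v)"
  using assms by (auto simp: frechet_derivative_works)

lemma Ck_on_Suc_imp_Ck_on: "Ck_on (Suc k) S f \<Longrightarrow> Ck_on k S f"
proof (induction k arbitrary: f)
  case 0
  then show ?case
    using differentiable_at_imp_differentiable_on[of S f] differentiable_imp_continuous_on[of f S]
    by simp
qed auto

lemma Ck_on_const: "Ck_on k S (\<lambda>x. c)"
  by (induction k arbitrary: c) auto

lemma Ck_on_add:
  assumes "open S" "Ck_on k S f" "Ck_on k S g"
  shows "Ck_on k S (\<lambda>x. f x + g x)"
  using assms(2,3)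
proof (induction k arbitrary: f g)
  case (Suc k)
  then show ?case
    by (intro Ck_on_SucI[OF assms(1) has_derivative_add]) (blast intro: Ck_on_SucD Suc.IH)+
qed (auto intro: continuous_on_add)

lemma Ck_on_bounded_linear:
  assumes "open S" "bounded_linear h" "Ck_on k S f"
  shows "Ck_on k S (\<lambda>x. h (f x))"
  using assms(3)
proof (induction k arbitrary: f)
  case 0
  then show ?case by (auto intro: bounded_linear.continuous_on[OF assms(2)])
next
  case (Suc k)
  then show ?case
    by (intro Ck_on_SucI[OF assms(1) bounded_linear.has_derivative[OF assms(2)]])
      (blast intro: Ck_on_SucD Suc.IH)+
qed

lemma Ck_on_mult:
  fixes f g :: "'a::euclidean_space \<Rightarrow> 'b::real_normed_algebra"
  assumes "open S" "Ck_on k S f" "Ck_on k S g"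
  shows "Ck_on k S (\<lambda>x. f x * g x)"
  using assms(2,3)
proof (induction k arbitrary: f g)
  case (Suc k)
  show ?case
    by (intro Ck_on_SucI[OF assms(1) has_derivative_mult] Ck_on_add assms(1) Suc.IH)
      (blast intro: Ck_on_SucD Ck_on_Suc_imp_Ck_on Suc.prems)+
qed (auto intro: continuous_on_mult)

lemma smooth_on_const: "smooth_on S (\<lambda>x. c)"
  by (simp add: smooth_on_def Ck_on_const)

lemma smooth_on_ident: "open S \<Longrightarrow> smooth_on S (\<lambda>x. x)"
proof -
  assume "open S"
  then have "Ck_on k S (\<lambda>x. x)" for k
    by (cases k) (simp, auto intro!: Ck_on_SucI[OF _ has_derivative_ident] Ck_on_const
      simp del: Ck_on.simps(2))
  then show ?thesis by (simp add: smooth_on_def)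
qed

lemma smooth_on_bounded_linear:
  "open S \<Longrightarrow> bounded_linear h \<Longrightarrow> smooth_on S f \<Longrightarrow> smooth_on S (\<lambda>x. h (f x))"
  by (simp add: smooth_on_def Ck_on_bounded_linear)

lemma smooth_on_add:
  "open S \<Longrightarrow> smooth_on S f \<Longrightarrow> smooth_on S g \<Longrightarrow> smooth_on S (\<lambda>x. f x + g x)"
  by (simp add: smooth_on_def Ck_on_add)

lemma smooth_on_mult:
  fixes f g :: "'a::euclidean_space \<Rightarrow> 'b::real_normed_algebra"
  shows "open S \<Longrightarrow> smooth_on S f \<Longrightarrow> smooth_on S g \<Longrightarrow> smooth_on S (\<lambda>x. f x * g x)"
  by (simp add: smooth_on_def Ck_on_mult)

lemma smooth_on_Pair:
  fixes f :: "'a::euclidean_space \<Rightarrow> 'b::real_normed_vector"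
    and g :: "'a::euclidean_space \<Rightarrow> 'c::real_normed_vector"
  assumes "open S" "smooth_on S f" "smooth_on S g"
  shows "smooth_on S (\<lambda>x. (f x, g x))"
proof -
  have "smooth_on S (\<lambda>x. (f x, 0::'c) + (0::'b, g x))"
    using assms
    by (intro smooth_on_add smooth_on_bounded_linear[of S "\<lambda>y. (y, 0)"]
        smooth_on_bounded_linear[of S "\<lambda>y. (0, y)"] bounded_linear_Pair
        bounded_linear_ident bounded_linear_zero)
  then show ?thesis by simp
qed

lemma has_derivative_cis:
  assumes "(g has_derivative g') (at x)"
  shows "((\<lambda>x. cis (g x)) has_derivative (\<lambda>h. of_real (g' h) * (\<i> * cis (g x)))) (at x)"
proof -
  have "((\<lambda>x. exp (\<i> * of_real (g x))) has_derivative
      (\<lambda>h. exp (\<i> * of_real (g x)) * (\<i> * of_real (g' h)))) (at x)"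
    by (rule has_derivative_compose[OF
          has_derivative_mult_right[OF has_derivative_of_real[OF assms]]
          DERIV_exp[unfolded has_field_derivative_def]])
  then show ?thesis by (simp add: cis_conv_exp mult_ac)
qed

text \<open>
  Each directional derivative of \<open>cis (c + l x)\<close> is a constant multiple of the function itself,
  so the induction on the order of differentiability closes.
\<close>

lemma smooth_on_cis_linear:
  fixes S :: "'a::euclidean_space set"
  assumes "open S" "bounded_linear l"
  shows "smooth_on S (\<lambda>x. cis (c + l x))"
proof -
  have "Ck_on k S (\<lambda>x. cis (c + l x))" for k
  proof (induction k)
    case 0
    show ?case
      by (simp add: cis_conv_exp) (intro continuous_intros bounded_linear.continuous_on[OF assms(2)])
  next
    case (Suc k)
    have "((\<lambda>x. cis (c + l x)) has_derivative (\<lambda>v. of_real (l v) * (\<i> * cis (c + l x)))) (at x)"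
      for x
      using has_derivative_add[OF has_derivative_const bounded_linear_imp_has_derivative[OF assms(2)]]
      by (intro has_derivative_cis) simp
    then show ?case
      by (rule Ck_on_SucI[OF assms(1)]) (intro Ck_on_mult Ck_on_const Suc.IH assms(1))
  qed
  then show ?thesis by (simp add: smooth_on_def)
qed


section \<open>Null planes\<close>

definition null_plane :: "real \<Rightarrow> complex \<times> complex \<Rightarrow> (complex \<times> complex) set" where
  "null_plane s z = {v \<in> sphere_tangent z. dtheta2 z v = s * dtheta1 z v}"

text \<open>The velocity of the torus action \<open>\<theta>\<^sub>1 \<mapsto> \<theta>\<^sub>1 + t\<close>, \<open>\<theta>\<^sub>2 \<mapsto> \<theta>\<^sub>2 + s t\<close>.\<close>

definition torus_field :: "real \<Rightarrow> complex \<times> complex \<Rightarrow> complex \<times> complex" where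
  "torus_field s z = (\<i> * fst z, of_real s * \<i> * snd z)"

text \<open>
  A positive multiple of the coordinate field \<open>\<partial>/\<partial>q\<close> of the boundary, scaled so as to be
  polynomial.  It keeps both angles and is tangent to the spheres.  It spans the normal direction
  of the null hypersurface, along which the two null planes meet.
\<close>

definition q_field :: "complex \<times> complex \<Rightarrow> complex \<times> complex" where
  "q_field z = ((cmod (snd z))\<^sup>2 *\<^sub>R fst z, - (cmod (fst z))\<^sup>2 *\<^sub>R snd z)"

lemma boundary_off_link_nonzero:
  assumes "z \<in> boundary_off_link"
  shows "fst z \<noteq> 0" "snd z \<noteq> 0"
proof -
  have n: "norm z = pi / 2" and q: "\<bar>coord_q z\<bar> < pi / 2"
    using assms by (auto simp: boundary_off_link_def)
  show "snd z \<noteq> 0"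
  proof
    assume "snd z = 0"
    moreover from this have "norm z = cmod (fst z)"
      by (simp add: norm_prod_def)
    ultimately have "\<bar>coord_q z\<bar> = norm z"
      by (simp add: coord_q_def power2_eq_square)
    then show False using n q by simp
  qed
  show "fst z \<noteq> 0"
  proof
    assume "fst z = 0"
    moreover from this have "norm z = cmod (snd z)"
      by (simp add: norm_prod_def)
    ultimately have "\<bar>coord_q z\<bar> = norm z"
      by (simp add: coord_q_def power2_eq_square)
    then show False using n q by simp
  qed
qed

lemma subspace_null_plane: "subspace (null_plane s z)"
  by (auto simp: subspace_def null_plane_def sphere_tangent_def dtheta1_def dtheta2_def
      inner_add_right add_divide_distrib distrib_left scaleR_conv_of_real
      simp flip: times_divide_eq_right)

lemma inner_mult_self: "x \<bullet> (a * x) = (cmod x)\<^sup>2 * Re a" for x a :: complex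
  unfolding cmod_power2 by (simp add: inner_complex_def algebra_simps power2_eq_square)

lemma torus_field_in_null_plane:
  assumes "fst z \<noteq> 0" "snd z \<noteq> 0"
  shows "torus_field s z \<in> null_plane s z"
  using assms
  by (simp add: null_plane_def sphere_tangent_def torus_field_def inner_prod_def inner_mult_self
      dtheta1_def dtheta2_def)

lemma dtheta_q_field:
  assumes "fst z \<noteq> 0" "snd z \<noteq> 0"
  shows "dtheta1 z (q_field z) = 0" "dtheta2 z (q_field z) = 0"
proof -
  have "Im ((r *\<^sub>R x) / x) = 0" if "x \<noteq> 0" for r and x :: complex
    using that by (simp add: scaleR_conv_of_real)
  then show "dtheta1 z (q_field z) = 0" "dtheta2 z (q_field z) = 0"
    using assms by (simp_all only: dtheta1_def dtheta2_def q_field_def fst_conv snd_conv)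
qed

lemma q_field_in_null_plane:
  assumes "fst z \<noteq> 0" "snd z \<noteq> 0"
  shows "q_field z \<in> null_plane s z"
  using dtheta_q_field[OF assms]
  by (simp add: null_plane_def sphere_tangent_def q_field_def inner_prod_def dot_square_norm)

text \<open>
  In the moving frame \<open>v = (a z\<^sub>1, b z\<^sub>2)\<close> the angular components of \<open>v\<close> are \<open>Im a\<close> and \<open>Im b\<close>,
  and tangency is the one equation \<open>\<bar>z\<^sub>1\<bar>\<^sup>2 Re a + \<bar>z\<^sub>2\<bar>\<^sup>2 Re b = 0\<close>.  Its solutions
  \<open>(Re a, Re b)\<close> are the multiples of \<open>(\<bar>z\<^sub>2\<bar>\<^sup>2, - \<bar>z\<^sub>1\<bar>\<^sup>2)\<close>, which is the frame expression of
  \<open>q_field\<close>.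
\<close>

lemma null_plane_eq_span:
  assumes z: "fst z \<noteq> 0" "snd z \<noteq> 0"
  shows "null_plane s z = span {torus_field s z, q_field z}"
proof
  show "span {torus_field s z, q_field z} \<subseteq> null_plane s z"
    using torus_field_in_null_plane[OF z] q_field_in_null_plane[OF z] subspace_null_plane
    by (intro span_minimal) auto
  show "null_plane s z \<subseteq> span {torus_field s z, q_field z}"
  proof
    fix v assume v: "v \<in> null_plane s z"
    define a where "a = fst v / fst z"
    define b where "b = snd v / snd z"
    define t where "t = Re a / (cmod (snd z))\<^sup>2"
    have v_eq: "v = (a * fst z, b * snd z)"
      using z by (simp add: a_def b_def prod_eq_iff)
    have im: "Im b = s * Im a"
      using v by (simp add: null_plane_def dtheta1_def dtheta2_def a_def b_def)
    have "(cmod (fst z))\<^sup>2 * Re a + (cmod (snd z))\<^sup>2 * Re b = 0"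
      using v unfolding v_eq by (simp add: null_plane_def sphere_tangent_def inner_prod_def inner_mult_self)
    then have re: "Re a = t * (cmod (snd z))\<^sup>2" "Re b = - t * (cmod (fst z))\<^sup>2"
      using z by (simp_all add: t_def field_simps)
    define m where "m = Im a"
    have ab: "a = of_real m * \<i> + of_real (t * (cmod (snd z))\<^sup>2)"
        "b = of_real m * (of_real s * \<i>) - of_real (t * (cmod (fst z))\<^sup>2)"
      using re im by (simp_all add: complex_eq_iff m_def)
    have "v = m *\<^sub>R torus_field s z + t *\<^sub>R q_field z"
      unfolding v_eq ab torus_field_def q_field_def
      by (simp add: scaleR_conv_of_real algebra_simps)
    then show "v \<in> span {torus_field s z, q_field z}"
      by (simp add: span_add span_scale span_base)
  qed
qed

lemma torus_field_orthogonal_q_field: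
  assumes z: "fst z \<noteq> 0" "snd z \<noteq> 0"
  shows "torus_field s z \<noteq> 0 \<and> q_field z \<noteq> 0 \<and> torus_field s z \<bullet> q_field z = 0"
  using z by (auto simp: torus_field_def q_field_def prod_eq_iff inner_prod_def inner_complex_def algebra_simps)

lemma dim_null_plane:
  assumes z: "fst z \<noteq> 0" "snd z \<noteq> 0"
  shows "dim (null_plane s z) = 2"
proof -
  have ne: "torus_field s z \<noteq> q_field z"
    using torus_field_orthogonal_q_field[OF z, of s] by auto
  have "independent {torus_field s z, q_field z}"
    using torus_field_orthogonal_q_field[OF z, of s]
    by (intro pairwise_orthogonal_independent)
      (auto simp: pairwise_def orthogonal_def inner_commute)
  then show ?thesis
    using ne by (simp add: null_plane_eq_span[OF z] dim_eq_card_independent)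
qed

text \<open>
  Each vector of a totally null plane satisfies \<open>(d\<theta>\<^sub>1)\<^sup>2 = (d\<theta>\<^sub>2)\<^sup>2\<close>, so the plane lies in the
  union of the two subspaces \<open>null_plane 1 z\<close> and \<open>null_plane (- 1) z\<close>.  A subspace in a union of
  two subspaces lies in one of them, and here the dimensions agree.
\<close>

lemma totally_null_plane_iff:
  assumes z: "z \<in> boundary_off_link"
  shows "totally_null_plane z P \<longleftrightarrow> P = null_plane 1 z \<or> P = null_plane (- 1) z"
proof
  note nz = boundary_off_link_nonzero[OF z]
  have "cos (coord_q z) > 0"
    using z by (auto simp: boundary_off_link_def intro!: cos_gt_zero_pi)
  then have c: "cos (coord_q z) \<noteq> 0" by simp
  {
    assume P: "totally_null_plane z P"
    then have sub: "subspace P" "P \<subseteq> sphere_tangent z" and d: "dim P = 2"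
      and null: "\<And>v w. v \<in> P \<Longrightarrow> w \<in> P \<Longrightarrow> conf_metric z v w = 0"
      by (auto simp: totally_null_plane_def)
    have sq: "v \<in> null_plane 1 z \<or> v \<in> null_plane (- 1) z" if "v \<in> P" for v
    proof -
      have "(dtheta2 z v)\<^sup>2 = (dtheta1 z v)\<^sup>2"
        using null[OF that that] conf_metric_induced[OF z, of v v] sub that c
        by (auto simp: power2_eq_square)
      then show ?thesis
        using sub that by (auto simp: null_plane_def power2_eq_iff)
    qed
    have "P \<subseteq> null_plane 1 z \<or> P \<subseteq> null_plane (- 1) z"
    proof (rule ccontr)
      assume "\<not> ?thesis"
      then obtain v w where vw: "v \<in> P" "v \<notin> null_plane 1 z" "w \<in> P" "w \<notin> null_plane (- 1) z"
        by blast
      then have v: "v \<in> null_plane (- 1) z" and w: "w \<in> null_plane 1 z" using sq by blast+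
      from sq[OF subspace_add[OF sub(1) vw(1,3)]] show False
      proof
        assume "v + w \<in> null_plane 1 z"
        from subspace_diff[OF subspace_null_plane this w] vw show False by simp
      next
        assume "v + w \<in> null_plane (- 1) z"
        from subspace_diff[OF subspace_null_plane this v] vw show False by simp
      qed
    qed
    then show "P = null_plane 1 z \<or> P = null_plane (- 1) z"
      using subspace_dim_equal[OF sub(1) subspace_null_plane] d dim_null_plane[OF nz]
      by (metis order_refl)
  }
  have "totally_null_plane z (null_plane s z)" if "s * s = 1" for s
  proof -
    have "conf_metric z v w = 0" if "v \<in> null_plane s z" "w \<in> null_plane s z" for v w
    proof -
      have "dtheta2 z v * dtheta2 z w = (s * s) * (dtheta1 z v * dtheta1 z w)"
        using that by (simp add: null_plane_def)
      moreover have "v \<in> sphere_tangent z" "w \<in> sphere_tangent z"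
        using that by (auto simp: null_plane_def)
      ultimately show ?thesis
        unfolding \<open>s * s = 1\<close> using conf_metric_induced[OF z, of v w] by simp
    qed
    then show ?thesis
      using subspace_null_plane dim_null_plane[OF nz]
      by (auto simp: totally_null_plane_def null_plane_def)
  qed
  from this[of 1] this[of "- 1"]
  show "P = null_plane 1 z \<or> P = null_plane (- 1) z \<Longrightarrow> totally_null_plane z P" by auto
qed


section \<open>Duality\<close>

lemma dp_eq: "z \<noteq> 0 \<Longrightarrow> dp z v = z \<bullet> v / norm z"
proof -
  assume z: "z \<noteq> 0"
  have "coord_p = norm" by (auto simp: coord_p_def)
  then have "dp z = (\<lambda>h. h \<bullet> sgn z)"
    using has_derivative_coord_p[OF z] has_derivative_norm[OF z] by (metis has_derivative_unique)
  then show ?thesis by (simp add: sgn_div_norm inner_commute divide_inverse)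
qed

lemma dq_eq:
  assumes z: "z \<noteq> 0" and v: "v \<in> sphere_tangent z"
  shows "dq z v = 2 * (fst z \<bullet> fst v - snd z \<bullet> snd v) / norm z"
proof -
  have eq: "coord_q = (\<lambda>z. (fst z \<bullet> fst z - snd z \<bullet> snd z) / coord_p z)"
    by (auto simp: coord_q_def coord_p_def dot_square_norm)
  have p: "coord_p z = norm z" "norm z \<noteq> 0" using z by (auto simp: coord_p_def)
  have "(coord_q has_derivative
     (\<lambda>v. - (fst z \<bullet> fst z - snd z \<bullet> snd z) * (inverse (norm z) * dp z v * inverse (norm z))
       + 2 * (fst z \<bullet> fst v - snd z \<bullet> snd v) / norm z)) (at z)"
    unfolding eq using p
    by (auto intro!: derivative_eq_intros has_derivative_coord_p[OF z]
        simp: fun_eq_iff inner_commute divide_inverse algebra_simps)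
  from fun_cong[OF has_derivative_unique[OF has_derivative_coord_q[OF z] this], of v]
  show ?thesis using dp_sphere_tangent[OF z v] by simp
qed

text \<open>
  For \<open>v\<close> and \<open>w\<close> in \<open>null_plane s z\<close> both \<open>dp\<close> and \<open>d\<theta>\<^sub>2 - s d\<theta>\<^sub>1\<close> vanish, so the bivector
  \<open>v \<and> w\<close> is determined by the number \<open>(dq \<and> d\<theta>\<^sub>1) (v, w)\<close>.  Lowering its indices
  turns it into a multiple of \<open>dp \<and> (d\<theta>\<^sub>1 - s d\<theta>\<^sub>2)\<close>.  Contracting the volume form with it gives
  a multiple of the same 2-form, and the ratio \<open>- s\<close> is the eigenvalue of the Hodge star.
\<close>

lemma conf_volume_conf_pairing_null_plane:
  assumes z: "z \<in> boundary_off_link" and s: "s * s = 1"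
    and vw: "v \<in> null_plane s z" "w \<in> null_plane s z"
  shows "conf_volume z x y v w = - s * conf_pairing z x y v w"
    and "conf_pairing z x y v w = (cos (coord_q z))\<^sup>2 / 8
      * (dq z v * dtheta1 z w - dq z w * dtheta1 z v)
      * (dp z x * (dtheta1 z y - s * dtheta2 z y) - dp z y * (dtheta1 z x - s * dtheta2 z x))"
proof -
  have z0: "z \<noteq> 0" and p: "coord_p z = pi / 2"
    using z by (auto simp: boundary_off_link_def coord_p_def)
  have sn: "sin (coord_p z + coord_q z) = cos (coord_q z)"
    "sin (coord_p z - coord_q z) = cos (coord_q z)"
    by (simp_all add: p sin_add sin_diff)
  have d: "dp z v = 0" "dp z w = 0"
    "dtheta2 z v = s * dtheta1 z v" "dtheta2 z w = s * dtheta1 z w"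
    using vw dp_sphere_tangent[OF z0] by (auto simp: null_plane_def)
  show pairing: "conf_pairing z x y v w = (cos (coord_q z))\<^sup>2 / 8
      * (dq z v * dtheta1 z w - dq z w * dtheta1 z v)
      * (dp z x * (dtheta1 z y - s * dtheta2 z y) - dp z y * (dtheta1 z x - s * dtheta2 z x))"
    unfolding conf_pairing_def conf_metric_def sn d by (simp add: field_simps power2_eq_square)
  have *: "dtheta1 z a * (s * t) - t * dtheta2 z a = s * t * (dtheta1 z a - s * dtheta2 z a)" for a t
    using s by (simp add: algebra_simps)
  show "conf_volume z x y v w = - s * conf_pairing z x y v w"
    unfolding pairing conf_volume_def wedge22_def wedge11_def sn d *
    by (simp add: field_simps power2_eq_square)
qed

text \<open>This is what keeps a null plane from being both an \<open>\<alpha>\<close>- and a \<open>\<beta>\<close>-plane.\<close>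

lemma conf_pairing_null_plane_nonzero:
  assumes z: "z \<in> boundary_off_link" and s: "s * s = 1"
  shows "\<exists>v\<in>null_plane s z. \<exists>w\<in>null_plane s z. \<exists>x y. conf_pairing z x y v w \<noteq> 0"
proof -
  note nz = boundary_off_link_nonzero[OF z]
  have z0: "z \<noteq> 0" using nz by auto
  have c: "cos (coord_q z) > 0"
    using z by (auto simp: boundary_off_link_def intro!: cos_gt_zero_pi)
  \<comment> \<open>By the factorised pairing, \<open>v\<close> and \<open>w\<close> must span the plane, \<open>x\<close> must be transversal to the
    sphere, and \<open>y\<close> may be any tangent vector outside \<open>d\<theta>\<^sub>1 = s d\<theta>\<^sub>2\<close>.\<close>
  let ?v = "q_field z" and ?w = "torus_field s z" and ?x = z and ?y = "(\<i> * fst z, 0)"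
  have v: "?v \<in> null_plane s z" and w: "?w \<in> null_plane s z"
    using q_field_in_null_plane[OF nz] torus_field_in_null_plane[OF nz] .
  have "dq z ?v = 4 * (cmod (fst z))\<^sup>2 * (cmod (snd z))\<^sup>2 / norm z"
    using dq_eq[OF z0, of ?v] v unfolding null_plane_def
    by (simp add: q_field_def dot_square_norm)
  then have "dq z ?v \<noteq> 0" using nz z0 by simp
  moreover have "dtheta1 z ?v = 0" "dtheta1 z ?w = 1"
    using nz dtheta_q_field[OF nz] by (simp_all add: torus_field_def dtheta1_def)
  moreover have "dp z ?x \<noteq> 0"
    using z0 by (simp add: dp_eq)
  moreover have "dp z ?y = 0"
    using z0 by (simp add: dp_eq inner_prod_def inner_mult_self)
  moreover have "dtheta1 z ?y = 1" "dtheta2 z ?y = 0"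
    using nz by (simp_all add: dtheta1_def dtheta2_def)
  ultimately have "conf_pairing z ?x ?y ?v ?w \<noteq> 0"
    using c unfolding conf_volume_conf_pairing_null_plane(2)[OF z s v w] by simp
  then show ?thesis using v w by blast
qed

lemma alpha_plane_iff:
  assumes z: "z \<in> boundary_off_link"
  shows "alpha_plane z P \<longleftrightarrow> P = null_plane (- 1) z"
proof -
  have "\<not> alpha_plane z (null_plane 1 z)"
  proof
    assume "alpha_plane z (null_plane 1 z)"
    have eq: "conf_volume z x y v w = conf_pairing z x y v w"
      if "v \<in> null_plane 1 z" "w \<in> null_plane 1 z" for x y v w
      using \<open>alpha_plane z (null_plane 1 z)\<close> that unfolding alpha_plane_def by blast
    have "conf_pairing z x y v w = 0" if "v \<in> null_plane 1 z" "w \<in> null_plane 1 z" for x y v w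
      using eq[OF that, of x y] conf_volume_conf_pairing_null_plane(1)[OF z _ that, of x y] by simp
    then show False
      using conf_pairing_null_plane_nonzero[OF z, of 1] by auto
  qed
  moreover have "alpha_plane z (null_plane (- 1) z)"
    using totally_null_plane_iff[OF z] conf_volume_conf_pairing_null_plane(1)[OF z, of "- 1"]
    unfolding alpha_plane_def by simp
  ultimately show ?thesis
    using totally_null_plane_iff[OF z, of P] unfolding alpha_plane_def by metis
qed

lemma beta_plane_iff:
  assumes z: "z \<in> boundary_off_link"
  shows "beta_plane z P \<longleftrightarrow> P = null_plane 1 z"
proof -
  have "\<not> beta_plane z (null_plane (- 1) z)"
  proof
    assume "beta_plane z (null_plane (- 1) z)"
    have eq: "- conf_volume z x y v w = conf_pairing z x y v w"
      if "v \<in> null_plane (- 1) z" "w \<in> null_plane (- 1) z" for x y v w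
      using \<open>beta_plane z (null_plane (- 1) z)\<close> that unfolding beta_plane_def by blast
    have "conf_pairing z x y v w = 0"
      if "v \<in> null_plane (- 1) z" "w \<in> null_plane (- 1) z" for x y v w
      using eq[OF that, of x y] conf_volume_conf_pairing_null_plane(1)[OF z _ that, of x y] by simp
    then show False
      using conf_pairing_null_plane_nonzero[OF z, of "- 1"] by auto
  qed
  moreover have "beta_plane z (null_plane 1 z)"
    using totally_null_plane_iff[OF z] conf_volume_conf_pairing_null_plane(1)[OF z, of 1]
    unfolding beta_plane_def by simp
  ultimately show ?thesis
    using totally_null_plane_iff[OF z, of P] unfolding beta_plane_def by metis
qed


section \<open>The leaves\<close>

lemma plane_distribution_null_plane:
  "plane_distribution boundary_off_link sphere_tangent (null_plane s)"
proof -
  have q: "q_field = (\<lambda>z. (snd z * cnj (snd z) * fst z, - (fst z * cnj (fst z)) * snd z))"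
    by (simp add: fun_eq_iff q_field_def scaleR_conv_of_real complex_norm_square del: of_real_power)
  have "smooth_on UNIV (torus_field s)" "smooth_on UNIV q_field"
    unfolding torus_field_def[abs_def] q
    by (intro smooth_on_Pair smooth_on_mult smooth_on_const open_UNIV
        smooth_on_bounded_linear[OF _ bounded_linear_cnj]
        smooth_on_bounded_linear[OF _ bounded_linear_fst]
        smooth_on_bounded_linear[OF _ bounded_linear_snd]
        smooth_on_bounded_linear[OF _ bounded_linear_minus[OF bounded_linear_ident]]
        smooth_on_ident)+
  then have "\<forall>z\<in>boundary_off_link. \<exists>U X Y. open U \<and> z \<in> U \<and> smooth_on U X \<and> smooth_on U Y \<and>
        (\<forall>w\<in>boundary_off_link \<inter> U. null_plane s w = span {X w, Y w})"
    using null_plane_eq_span boundary_off_link_nonzero by (metis IntD1 UNIV_I open_UNIV)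
  then show ?thesis
    unfolding plane_distribution_def
    using subspace_null_plane dim_null_plane boundary_off_link_nonzero
    by (auto simp: null_plane_def)
qed

text \<open>A map into the surface \<open>\<theta>\<^sub>2 - s \<theta>\<^sub>1 = b - s a\<close> of the boundary sphere.\<close>

definition leaf :: "real \<Rightarrow> real \<Rightarrow> real \<Rightarrow> real \<times> real \<Rightarrow> complex \<times> complex" where
  "leaf s a b = (\<lambda>(\<psi>, u). ball_point (pi / 2) \<psi> (a + u) (b + s * u))"

lemma ball_point_in_boundary_off_link:
  assumes "0 < \<psi>" "\<psi> < pi"
  shows "ball_point (pi / 2) \<psi> \<theta>1 \<theta>2 \<in> boundary_off_link"
proof -
  have "cos \<psi> < 1" "cos \<psi> > - 1"
    using assms cos_monotone_0_pi[of 0 \<psi>] cos_monotone_0_pi[of \<psi> pi] by auto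
  then have "\<bar>pi / 2 * cos \<psi>\<bar> < pi / 2"
    by (simp add: abs_mult abs_less_iff)
  then show ?thesis
    by (simp add: boundary_off_link_def norm_ball_point coord_p_q_ball_point)
qed

text \<open>Since \<open>q = (pi / 2) cos \<psi>\<close> there, the Hopf link is exactly \<open>\<psi> = 0\<close> and \<open>\<psi> = pi\<close>.\<close>

lemma boundary_off_link_eq_ball_point:
  assumes "z \<in> boundary_off_link"
  obtains \<psi> a b where "0 < \<psi>" "\<psi> < pi" "z = ball_point (pi / 2) \<psi> a b"
proof -
  note nz = boundary_off_link_nonzero[OF assms]
  let ?x = "cmod (fst z) / (pi / 2)" and ?y = "cmod (snd z) / (pi / 2)"
  have "norm z = pi / 2" using assms by (simp add: boundary_off_link_def)
  then have "(cmod (fst z))\<^sup>2 + (cmod (snd z))\<^sup>2 = (pi / 2)\<^sup>2"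
    by (metis norm_prod_def real_sqrt_pow2 sum_power2_ge_zero)
  then have "?x\<^sup>2 + ?y\<^sup>2 = 1"
    by (simp add: power_divide field_simps)
  then obtain t where t: "0 \<le> t" "t \<le> pi / 2" "?x = cos t" "?y = sin t"
    using sincos_total_pi_half[of ?x ?y] by auto
  have "cos t \<noteq> 0" "sin t \<noteq> 0" using t(3,4)[symmetric] nz by auto
  then have "t \<noteq> 0" "t \<noteq> pi / 2" using cos_pi_half sin_zero by metis+
  then have "0 < 2 * t" "2 * t < pi" using t by auto
  moreover have "z = ball_point (pi / 2) (2 * t) (Arg (fst z)) (Arg (snd z))"
  proof -
    have "pi / 2 * cos t = cmod (fst z)" "pi / 2 * sin t = cmod (snd z)"
      using t(3,4) by (simp_all add: field_simps)
    then show ?thesis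
      using rcis_cmod_Arg[of "fst z"] rcis_cmod_Arg[of "snd z"]
      by (simp add: ball_point_def prod_eq_iff rcis_def flip: of_real_mult)
  qed
  ultimately show ?thesis using that by blast
qed

lemma smooth_on_leaf:
  assumes "open W"
  shows "smooth_on W (leaf s a b)"
proof -
  have l: "bounded_linear (\<lambda>h::real \<times> real. fst h / 2)" "bounded_linear (\<lambda>h::real \<times> real. snd h)"
    "bounded_linear (\<lambda>h::real \<times> real. s * snd h)"
    by (auto intro!: bounded_linear_intros bounded_linear_compose[OF bounded_linear_divide])
  have "smooth_on W (\<lambda>h. (complex_of_real (pi / 2) * complex_of_real (Re (cis (0 + fst h / 2))) * cis (a + snd h),
     complex_of_real (pi / 2) * complex_of_real (Im (cis (0 + fst h / 2))) * cis (b + s * snd h)))"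
    by (intro smooth_on_Pair smooth_on_mult smooth_on_const assms smooth_on_cis_linear l
        smooth_on_bounded_linear[OF _ bounded_linear_of_real]
        smooth_on_bounded_linear[OF _ bounded_linear_Re]
        smooth_on_bounded_linear[OF _ bounded_linear_Im])
  then show ?thesis
    by (simp add: leaf_def ball_point_def case_prod_beta')
qed

text \<open>
  The constant \<open>c\<close> compares \<open>\<partial>/\<partial>\<psi>\<close> with \<open>q_field\<close>, whose components carry the factors
  \<open>\<bar>z\<^sub>2\<bar>\<^sup>2\<close> and \<open>\<bar>z\<^sub>1\<bar>\<^sup>2\<close>.  It is negative because \<open>q\<close> decreases in \<open>\<psi>\<close>.
\<close>

lemma has_derivative_leaf:
  fixes s a b \<psi> u :: real
  assumes "0 < \<psi>" "\<psi> < pi"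
  defines "z \<equiv> leaf s a b (\<psi>, u)"
  defines "c \<equiv> - 1 / (pi\<^sup>2 / 2 * (sin (\<psi> / 2) * cos (\<psi> / 2)))"
  shows "(leaf s a b has_derivative (\<lambda>h. (c * fst h) *\<^sub>R q_field z + snd h *\<^sub>R torus_field s z))
    (at (\<psi>, u))"
proof -
  have sc: "sin (\<psi> / 2) > 0" "cos (\<psi> / 2) > 0"
    using assms(1,2) by (auto intro!: sin_gt_zero cos_gt_zero)
  have "(leaf s a b has_derivative
    (\<lambda>h. (fst h / 2) *\<^sub>R (of_real (- (pi / 2) * sin (\<psi> / 2)) * cis (a + u),
        of_real (pi / 2 * cos (\<psi> / 2)) * cis (b + s * u))
      + snd h *\<^sub>R torus_field s z)) (at (\<psi>, u))"
    unfolding leaf_def ball_point_def case_prod_beta' z_def torus_field_def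
    by (auto intro!: derivative_eq_intros has_derivative_cis simp: fun_eq_iff scaleR_conv_of_real field_simps)
  moreover have "(t / 2) *\<^sub>R (of_real (- (pi / 2) * sin (\<psi> / 2)) * cis (a + u),
        of_real (pi / 2 * cos (\<psi> / 2)) * cis (b + s * u)) = (c * t) *\<^sub>R q_field z" for t
    unfolding q_field_def z_def leaf_def ball_point_def
    using sc by (simp add: norm_mult c_def scaleR_conv_of_real field_simps power2_eq_square)
  ultimately show ?thesis by simp
qed

text \<open>
  Injectivity needs the parameter \<open>u\<close> confined to one turn of \<open>z\<^sub>1\<close>; then \<open>\<psi>\<close> is recovered from
  \<open>q\<close> and \<open>u\<close> from the phase of \<open>z\<^sub>1\<close>.  The derivative has the two-dimensional image spanned by
  the orthogonal fields \<open>q_field\<close> and \<open>torus_field s\<close>.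
\<close>

lemma integral_surface_leaf:
  "integral_surface boundary_off_link (null_plane s) ({0<..<pi} \<times> {-pi<..<pi}) (leaf s a b)"
  (is "integral_surface _ _ ?W _")
proof -
  have inj: "inj_on (leaf s a b) ?W"
  proof (rule inj_onI, clarify)
    fix \<psi> u \<psi>' u'
    assume eq: "leaf s a b (\<psi>, u) = leaf s a b (\<psi>', u')"
      and r: "\<psi> \<in> {0<..<pi}" "\<psi>' \<in> {0<..<pi}" "u \<in> {-pi<..<pi}" "u' \<in> {-pi<..<pi}"
    have "pi / 2 * cos \<psi> = pi / 2 * cos \<psi>'"
      using arg_cong[OF eq, of coord_q] by (simp add: leaf_def coord_p_q_ball_point)
    then have "cos \<psi> = cos \<psi>'" by simp
    then have \<psi>: "\<psi> = \<psi>'"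
      using r cos_inj_pi[of \<psi> \<psi>'] by simp
    have "cos (\<psi> / 2) \<noteq> 0"
      using r cos_gt_zero[of "\<psi> / 2"] by auto
    then have "cis (a + u) = cis (a + u')"
      using eq unfolding \<psi> by (simp add: leaf_def ball_point_def)
    then have "cis u = cis u'"
      by (simp add: cis_mult [symmetric])
    then have "u = u'"
      using r cis_Arg_unique[of "cis u" u] cis_Arg_unique[of "cis u" u'] by auto
    with \<psi> show "\<psi> = \<psi>' \<and> u = u'" by simp
  qed
  have img: "leaf s a b h \<in> boundary_off_link" if "h \<in> ?W" for h
    using that by (auto simp: leaf_def intro: ball_point_in_boundary_off_link)
  have deriv: "inj (frechet_derivative (leaf s a b) (at h)) \<and>
        range (frechet_derivative (leaf s a b) (at h)) = null_plane s (leaf s a b h)"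
    if h: "h \<in> ?W" for h
  proof -
    obtain \<psi> u where hu: "h = (\<psi>, u)" "0 < \<psi>" "\<psi> < pi" using h by auto
    define z where "z = leaf s a b h"
    define X where "X = torus_field s z"
    define Y where "Y = q_field z"
    define c where "c = - 1 / (pi\<^sup>2 / 2 * (sin (\<psi> / 2) * cos (\<psi> / 2)))"
    define D where "D = (\<lambda>k::real \<times> real. (c * fst k) *\<^sub>R Y + snd k *\<^sub>R X)"
    note nz = boundary_off_link_nonzero[OF img[OF h], folded z_def]
    have XY: "X \<noteq> 0" "Y \<noteq> 0" "X \<bullet> Y = 0"
      using torus_field_orthogonal_q_field[OF nz] by (auto simp: X_def Y_def)
    have "sin (\<psi> / 2) > 0" "cos (\<psi> / 2) > 0"
      using hu by (auto intro!: sin_gt_zero cos_gt_zero)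
    then have c: "c \<noteq> 0" by (simp add: c_def)
    have der: "(leaf s a b has_derivative D) (at h)"
      using has_derivative_leaf[OF hu(2,3), of s a b u] by (simp add: D_def X_def Y_def z_def c_def hu(1))
    then have fd: "frechet_derivative (leaf s a b) (at h) = D"
      using frechet_derivative_at by metis
    have lin: "linear D" using der has_derivative_linear by blast
    have "inj D"
      unfolding linear_injective_0[OF lin]
    proof (intro allI impI)
      fix k assume k: "D k = 0"
      have "D k \<bullet> X = snd k * (X \<bullet> X)" "D k \<bullet> Y = c * fst k * (Y \<bullet> Y)"
        using XY by (simp_all add: D_def inner_add_left inner_commute[of Y X])
      then have "fst k = 0" "snd k = 0" using XY c unfolding k by simp_all
      then show "k = 0" by (simp add: prod_eq_iff)
    qed
    moreover have "range D = null_plane s z"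
    proof (rule subspace_dim_equal)
      show "subspace (range D)" using lin linear_subspace_image subspace_UNIV by blast
      show "subspace (null_plane s z)" by (rule subspace_null_plane)
      show "range D \<subseteq> null_plane s z"
        unfolding null_plane_eq_span[OF nz] D_def X_def Y_def
        by (rule image_subsetI) (simp add: span_add span_scale span_base)
      show "dim (range D) \<ge> dim (null_plane s z)"
        using dim_image_eq[OF lin, of UNIV] \<open>inj D\<close> by (simp add: dim_null_plane[OF nz])
    qed
    ultimately show ?thesis by (simp add: fd z_def)
  qed
  show ?thesis
    unfolding integral_surface_def using inj img deriv
    by (auto intro!: smooth_on_leaf open_Times)
qed

lemma integrable_null_plane:
  "integrable_distribution boundary_off_link sphere_tangent (null_plane s)"
  unfolding integrable_distribution_def
proof (intro conjI plane_distribution_null_plane ballI)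
  fix z assume "z \<in> boundary_off_link"
  then obtain \<psi> a b where z: "0 < \<psi>" "\<psi> < pi" "z = ball_point (pi / 2) \<psi> a b"
    by (rule boundary_off_link_eq_ball_point)
  then have "z = leaf s a b (\<psi>, 0)" by (simp add: leaf_def)
  then have "z \<in> leaf s a b ` ({0<..<pi} \<times> {-pi<..<pi})"
    using z by auto
  then show "\<exists>W f. integral_surface boundary_off_link (null_plane s) W f \<and> z \<in> f ` W"
    using integral_surface_leaf by blast
qed

theorem proposition3:
  shows "(\<exists>A. (\<forall>z\<in>boundary_off_link. \<forall>P. alpha_plane z P \<longleftrightarrow> P = A z) \<and>
              integrable_distribution boundary_off_link sphere_tangent A) \<and>
         (\<exists>B. (\<forall>z\<in>boundary_off_link. \<forall>P. beta_plane z P \<longleftrightarrow> P = B z) \<and>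
              integrable_distribution boundary_off_link sphere_tangent B)"
proof
  show "\<exists>A. (\<forall>z\<in>boundary_off_link. \<forall>P. alpha_plane z P \<longleftrightarrow> P = A z) \<and>
      integrable_distribution boundary_off_link sphere_tangent A"
    by (intro exI[of _ "null_plane (- 1)"]) (simp add: alpha_plane_iff integrable_null_plane)
  show "\<exists>B. (\<forall>z\<in>boundary_off_link. \<forall>P. beta_plane z P \<longleftrightarrow> P = B z) \<and>
      integrable_distribution boundary_off_link sphere_tangent B"
    by (intro exI[of _ "null_plane 1"]) (simp add: beta_plane_iff integrable_null_plane)
qed

end
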